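(* Let $K$ be a field of characteristic zero, let $a,b\in K$ with $a\neq0$, and let $c$ be an indeterminate (parameter). Let $p(t)=a+bt+ct^2$, $h(t)=tp(t)$, let $\bar h(t)\in K[c][[t]]$ be the compositional inverse of $h(t)$ (so $h(\bar h(t))=\bar h(h(t))=t$), and let $A(t)=t/\bar h(t)$, a formal power series in $t$ whose coefficients are polynomials in $c$. Then for every integer $n\ge0$, $$[t^{n+2}]\left.\frac{d A(t)}{dc}\right|_{c=0}=\frac{(-b)^n}{a^{2n+2}}\binom{2n+1}{n+1},$$ where the derivative with respect to $c$ is taken coefficientwise.
   Context: $[t^m]f(t)$ denotes the coefficient of $t^m$ in the formal power series $f(t)$. $A(t)$ is the generating function of the A-sequence of the Riordan array $\bigl(1/(1-t^3),\,tp(t)\bigr)$. *)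

theory Defs
  imports "HOL-Computational_Algebra.Computational_Algebra"
begin

text \<open>
  Series in \<open>t\<close> with coefficients in \<open>K[c]\<close> have type \<open>'a poly fps\<close>; the polynomial variable is
  the indeterminate \<open>c\<close>, so \<open>[:0, 1:]\<close> is \<open>c\<close>. The library operations \<^const>\<open>fps_inv\<close> and
  division of power series need division in the coefficient ring and are not available over \<open>K[c]\<close>,
  hence the following two definitions over an arbitrary commutative ring.
\<close>

text \<open>
  The condition \<open>g $ 0 = 0\<close> is required because \<^const>\<open>fps_compose\<close> is total and only has
  its intended meaning when the inner series has no constant term.
\<close>

definition fps_comp_inverse :: "'a::comm_ring_1 fps \<Rightarrow> 'a fps" where
  "fps_comp_inverse f = (THE g. g $ 0 = 0 \<and> f oo g = fps_X \<and> g oo f = fps_X)"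

definition fps_quotient :: "'a::comm_ring_1 fps \<Rightarrow> 'a fps \<Rightarrow> 'a fps" where
  "fps_quotient f g = (THE q. q * g = f)"

end

theory Submission
  imports Defs
begin

text \<open>
  Since \<open>h(hbar) = t\<close> reads \<open>hbar \<cdot> p(hbar) = t\<close>, the series \<open>A\<close> is \<open>p(hbar)\<close>. Write \<open>g\<close> and \<open>g1\<close> for
  the value and the \<open>c\<close>-derivative of \<open>hbar\<close> at \<open>c = 0\<close>. Then \<open>a g + b g\<^sup>2 = t\<close> and
  \<open>(a + 2 b g) g1 = - g\<^sup>3\<close>, while differentiating in \<open>t\<close> gives \<open>(a + 2 b g) g' = 1\<close>; together these
  show that the \<open>c\<close>-derivative of \<open>A\<close> at \<open>c = 0\<close> is \<open>b g1 + g\<^sup>2 = t g g'\<close>. Finally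
  \<open>g'\<^sup>2 (a\<^sup>2 + 4 b t) = 1\<close> makes \<open>g'\<close> a central binomial series, and \<open>2 b g g' = 1 - a g'\<close>.
\<close>

text \<open>The coefficient of t^n in \<open>g oo f\<close> involves only the coefficients of
  \<open>g\<close> up to n, the last one with the factor \<open>(f $ 1) ^ n\<close>. Since
  \<open>u ^ n\<close> cancels this factor, the coefficients can be solved for recursively without
  division, hence also over K[c].\<close>

lemma fps_left_comp_inverse_exists:
  fixes f :: "'a::comm_ring_1 fps"
  assumes f0: "f $ 0 = 0" and u: "f $ 1 * u = 1"
  shows "\<exists>g. g $ 0 = 0 \<and> g $ 1 = u \<and> g oo f = fps_X"
proof -
  define G where "G = (wfrec less_than
    (\<lambda>G n. (fps_X $ n - (\<Sum>i<n. G i * (f ^ i) $ n)) * u ^ n) :: nat \<Rightarrow> 'a)"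
  have G: "G n = (fps_X $ n - (\<Sum>i<n. G i * (f ^ i) $ n)) * u ^ n" for n
    unfolding G_def by (subst wfrec) (auto simp: cut_apply)
  define g where "g = Abs_fps G"
  have "(g oo f) $ n = fps_X $ n" for n
  proof -
    have "(g oo f) $ n = (\<Sum>i<n. G i * (f ^ i) $ n) + G n * (f ^ n) $ n"
      by (simp add: fps_compose_nth g_def atLeast0AtMost flip: lessThan_Suc_atMost)
    also have "(f ^ n) $ n = (f $ 1) ^ n"
      using f0 by (simp add: startsby_zero_power_nth_same)
    also have "G n * (f $ 1) ^ n =
      (fps_X $ n - (\<Sum>i<n. G i * (f ^ i) $ n)) * (f $ 1 * u) ^ n"
      by (subst G) (simp add: power_mult_distrib mult_ac)
    finally show ?thesis by (simp only: u) simp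
  qed
  moreover have "g $ 0 = 0" using G[of 0] by (simp add: g_def)
  moreover have "g $ 1 = u" using G[of 1] G[of 0] by (simp add: g_def)
  ultimately show ?thesis by (auto simp: fps_eq_iff)
qed

text \<open>A left inverse \<open>g\<close> has the invertible linear coefficient \<open>u\<close>,
  so it has a left inverse \<open>k\<close> in turn. Associativity forces \<open>k = f\<close>,
  which makes \<open>g\<close> two-sided; associativity again gives uniqueness, so the definite
  description is meaningful.\<close>

lemma fps_comp_inverse_works:
  fixes f :: "'a::idom fps"
  assumes f0: "f $ 0 = 0" and u: "f $ 1 * u = 1"
  shows "fps_comp_inverse f $ 0 = 0" "f oo fps_comp_inverse f = fps_X"
    "fps_comp_inverse f oo f = fps_X"
proof -
  obtain g where g: "g $ 0 = 0" "g $ 1 = u" "g oo f = fps_X"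
    using fps_left_comp_inverse_exists[OF f0 u] by blast
  have "g $ 1 * f $ 1 = 1" using u g by (simp add: mult.commute)
  then obtain k where k: "k $ 0 = 0" "k oo g = fps_X"
    using fps_left_comp_inverse_exists[OF g(1)] by blast
  have "k = k oo (g oo f)" by (simp add: g)
  also have "\<dots> = f"
    using f0 k by (simp add: fps_compose_assoc[OF f0 g(1)])
  finally have fg: "f oo g = fps_X" using k by simp
  have "\<exists>!g. g $ 0 = 0 \<and> f oo g = fps_X \<and> g oo f = fps_X"
  proof (rule ex1I[of _ g])
    fix q assume q: "q $ 0 = 0 \<and> f oo q = fps_X \<and> q oo f = fps_X"
    have "q = q oo (f oo g)" by (simp add: fg)
    also have "\<dots> = g" using g q by (simp add: fps_compose_assoc[OF g(1) f0])
    finally show "q = g" .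
  qed (use g fg in auto)
  from theI'[OF this] show "fps_comp_inverse f $ 0 = 0" "f oo fps_comp_inverse f = fps_X"
    "fps_comp_inverse f oo f = fps_X"
    by (auto simp: fps_comp_inverse_def)
qed

lemma fps_quotient_eqI:
  fixes f g q :: "'a::idom fps"
  assumes "q * g = f" "g \<noteq> 0"
  shows "fps_quotient f g = q"
  unfolding fps_quotient_def using assms by (intro the_equality) auto

text \<open>Together with \<open>fps_pderiv0\<close> this records a series modulo c^2. The first map
  is a ring homomorphism and the second a derivation along it, so identities over K[c] pass to
  K.\<close>

definition fps_eval0 :: "'a::comm_ring_1 poly fps \<Rightarrow> 'a fps" where
  "fps_eval0 f = Abs_fps (\<lambda>n. poly (f $ n) 0)"

definition fps_pderiv0 :: "'a::idom poly fps \<Rightarrow> 'a fps" where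
  "fps_pderiv0 f = Abs_fps (\<lambda>n. poly (pderiv (f $ n)) 0)"

lemma fps_eval0_add: "fps_eval0 (f + g) = fps_eval0 f + fps_eval0 g"
  by (simp add: fps_eval0_def fps_eq_iff)

lemma fps_eval0_mult: "fps_eval0 (f * g) = fps_eval0 f * fps_eval0 g"
  by (simp add: fps_eval0_def fps_eq_iff fps_mult_nth poly_sum)

lemma fps_eval0_const: "fps_eval0 (fps_const q) = fps_const (poly q 0)"
  by (simp add: fps_eval0_def fps_eq_iff)

lemma fps_eval0_X: "fps_eval0 fps_X = fps_X"
  by (simp add: fps_eval0_def fps_eq_iff)

lemma fps_pderiv0_add: "fps_pderiv0 (f + g) = fps_pderiv0 f + fps_pderiv0 g"
  by (simp add: fps_pderiv0_def fps_eq_iff pderiv_add)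

lemma pderiv_sum: "pderiv (\<Sum>x\<in>S. f x) = (\<Sum>x\<in>S. pderiv (f x))"
  by (induction S rule: infinite_finite_induct) (simp_all add: pderiv_add)

lemma fps_pderiv0_mult:
  "fps_pderiv0 (f * g) = fps_pderiv0 f * fps_eval0 g + fps_eval0 f * fps_pderiv0 g"
proof (rule fps_ext)
  fix n
  show "fps_pderiv0 (f * g) $ n
      = (fps_pderiv0 f * fps_eval0 g + fps_eval0 f * fps_pderiv0 g) $ n"
    by (simp add: fps_pderiv0_def fps_eval0_def fps_mult_nth poly_sum pderiv_sum pderiv_mult
        flip: sum.distrib) (simp add: add.commute mult.commute)
qed

lemma fps_pderiv0_const: "fps_pderiv0 (fps_const q) = fps_const (poly (pderiv q) 0)"
  by (simp add: fps_pderiv0_def fps_eq_iff)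

lemma fps_pderiv0_X: "fps_pderiv0 fps_X = 0"
  by (simp add: fps_pderiv0_def fps_eq_iff fps_X_def)

lemmas fps_eval0_simps = fps_eval0_add fps_eval0_mult fps_eval0_const fps_eval0_X
lemmas fps_pderiv0_simps = fps_pderiv0_add fps_pderiv0_mult fps_pderiv0_const fps_pderiv0_X

text \<open>Here \<open>w\<close> is (a^2 + 4bt)^(-1/2), with the sign of the root fixed by
  \<open>w0\<close>. Differentiating \<open>w\<close> yields a first-order linear ODE, and its
  coefficients give a two-term recurrence that the scaled central binomials satisfy.\<close>

lemma inverse_sqrt_fps_nth:
  fixes w :: "'a::field_char_0 fps"
  assumes a: "a \<noteq> 0" and w0: "w $ 0 = 1 / a"
    and w: "w ^ 2 * (fps_const (a ^ 2) + fps_const (4 * b) * fps_X) = 1"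
  shows "w $ k = (- b) ^ k / a ^ (2 * k + 1) * of_nat ((2 * k) choose k)"
proof -
  let ?s = "fps_const (a ^ 2) + fps_const (4 * b) * fps_X"
  have "w \<noteq> 0" using w by auto
  have "fps_deriv (w ^ 2 * ?s) = 0" by (simp add: w)
  then have "w * (2 * fps_deriv w * ?s + fps_const (4 * b) * w) = 0"
    by (simp add: power2_eq_square algebra_simps)
  with \<open>w \<noteq> 0\<close> have ode: "2 * fps_deriv w * ?s + fps_const (4 * b) * w = 0" by simp
  have rec: "a ^ 2 * (of_nat (Suc k) * w $ Suc k) = - (b * of_nat (4 * k + 2) * w $ k)" for k
  proof -
    have two: "fps_const (2 * b) = 2 * fps_const b" "fps_const (4 * b) = 4 * fps_const b"
      by (simp_all add: numeral_fps_const)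
    have "2 * (fps_const (a ^ 2) * fps_deriv w +
        fps_const (4 * b) * (fps_X * fps_deriv w) + fps_const (2 * b) * w)
        = 2 * fps_deriv w * ?s + fps_const (4 * b) * w"
      unfolding two by (simp add: algebra_simps)
    then have "fps_const (a ^ 2) * fps_deriv w +
        fps_const (4 * b) * (fps_X * fps_deriv w) + fps_const (2 * b) * w = 0"
      unfolding ode by (metis mult_eq_0_iff zero_neq_numeral)
    then have "(fps_const (a ^ 2) * fps_deriv w +
        fps_const (4 * b) * (fps_X * fps_deriv w) + fps_const (2 * b) * w) $ k = 0"
      by (simp only: fps_zero_nth)
    then have "a ^ 2 * (of_nat (Suc k) * w $ Suc k) + 4 * b * (of_nat k * w $ k) + 2 * b * w $ k = 0"
      \<comment> \<open>Multiplication by \<open>fps_X\<close> shifts the index, so k = 0 is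
        separate: there the middle term vanishes.\<close>
      by (cases k) (auto simp: add.assoc)
    then show ?thesis by (simp add: algebra_simps add_eq_0_iff)
  qed
  show ?thesis
  proof (induction k)
    case 0
    then show ?case by (simp add: w0)
  next
    case (Suc k)
    have "Suc k * ((2 * Suc k) choose Suc k) = (4 * k + 2) * ((2 * k) choose k)"
    proof -
      have 1: "Suc k * (Suc (2 * k + 1) choose Suc k) = Suc (2 * k + 1) * ((2 * k + 1) choose k)"
        by (rule Suc_times_binomial)
      have 2: "Suc k * ((2 * k + 1) choose k) = (2 * k + 1) * ((2 * k) choose k)"
        using binomial_absorb_comp[of "2 * k + 1" k] by simp
      show ?thesis using 1 2 by (simp add: algebra_simps)
    qed
    then have c: "of_nat (Suc k) * of_nat ((2 * Suc k) choose Suc k)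
        = (of_nat (4 * k + 2) * of_nat ((2 * k) choose k) :: 'a)"
      by (metis of_nat_mult)
    have "of_nat (Suc k) * w $ Suc k = - (b * of_nat (4 * k + 2) * w $ k) / a ^ 2"
      using rec[of k] a by (simp add: field_simps)
    also have "\<dots> = (- b) ^ Suc k / a ^ (2 * Suc k + 1) *
        (of_nat (4 * k + 2) * of_nat ((2 * k) choose k))"
      unfolding Suc.IH using a by (simp add: power_add power2_eq_square mult_ac)
    also have "\<dots> = of_nat (Suc k) *
        ((- b) ^ Suc k / a ^ (2 * Suc k + 1) * of_nat ((2 * Suc k) choose Suc k))"
      unfolding c[symmetric] by (simp add: mult_ac)
    finally show ?case by (simp only: mult_left_cancel[OF of_nat_neq_0])
  qed
qed

lemma quadratic_inverse_mult_deriv_nth: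
  fixes g :: "'a::field_char_0 fps"
  assumes a: "a \<noteq> 0" and g0: "g $ 0 = 0"
    and g: "fps_const a * g + fps_const b * g ^ 2 = fps_X"
  shows "(g * fps_deriv g) $ (n + 1)
    = (- b) ^ n / a ^ (2 * n + 2) * of_nat ((2 * n + 1) choose (n + 1))"
proof -
  let ?d = "fps_const a + fps_const (2 * b) * g"
  have two: "fps_const (2 * b) = 2 * fps_const b" "fps_const (4 * b) = 4 * fps_const b"
    by (simp_all add: numeral_fps_const)
  have "fps_deriv (fps_const a * g + fps_const b * g ^ 2) = 1" by (simp add: g)
  then have dg: "fps_deriv g * ?d = 1"
    unfolding two by (simp add: power2_eq_square algebra_simps)
  show ?thesis
  proof (cases "b = 0")
    \<comment> \<open>The general argument divides by 2b. Here g = t/a, so g g' = t/a^2, which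
      agrees with the formula because \<open>(- b) ^ n\<close> is 1 for n = 0 and 0
      otherwise.\<close>
    case True
    have "g = fps_const (1 / a) * (fps_const a * g)"
      using a by (simp flip: mult.assoc)
    with g True have "g = fps_const (1 / a) * fps_X" by simp
    then show ?thesis using True a
      by (cases n) (auto simp: power2_eq_square)
  next
    case False
    \<comment> \<open>Completing the square turns the quadratic equation for \<open>g\<close> into
      one for a + 2bg, the inverse of g'.\<close>
    have "?d ^ 2 = fps_const (a ^ 2) + fps_const (4 * b) * (fps_const a * g + fps_const b * g ^ 2)"
      unfolding two fps_const_power[symmetric] by algebra
    then have sq: "fps_const (a ^ 2) + fps_const (4 * b) * fps_X = ?d ^ 2" by (simp add: g)
    have "(fps_deriv g)\<^sup>2 * (fps_const (a ^ 2) + fps_const (4 * b) * fps_X) = 1"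
      unfolding sq by (simp add: dg flip: power_mult_distrib)
    moreover have "fps_deriv g $ 0 = 1 / a"
      using arg_cong[OF dg, of "\<lambda>f. f $ 0"] a g0 by (simp add: field_simps)
    ultimately have w: "fps_deriv g $ (n + 1)
        = (- b) ^ (n + 1) / a ^ (2 * (n + 1) + 1) * of_nat ((2 * (n + 1)) choose (n + 1))"
      using inverse_sqrt_fps_nth[OF a] by blast
    \<comment> \<open>The right-hand side of \<open>dg\<close> is the constant 1, which has no
      coefficient in degree n + 1.\<close>
    have "(fps_const a * fps_deriv g + fps_const (2 * b) * (g * fps_deriv g)) $ (n + 1) = 0"
      using dg by (simp add: algebra_simps)
    then have "a * fps_deriv g $ (n + 1) + 2 * b * (g * fps_deriv g) $ (n + 1) = 0"
      by (simp only: fps_add_nth fps_mult_left_const_nth)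
    then have u: "2 * b * (g * fps_deriv g) $ (n + 1) = - (a * fps_deriv g $ (n + 1))"
      by (simp only: eq_neg_iff_add_eq_0 add.commute)
    \<comment> \<open>The two equal middle entries of an odd row add up to the central binomial
      below them; this supplies the 2 of the factor 2b to be cancelled, and
      \<open>(- b) ^ (n + 1)\<close> supplies the b.\<close>
    have "(2 * n + 1) choose n = (2 * n + 1) choose (n + 1)"
      by (subst binomial_symmetric) auto
    then have "(2 * (n + 1)) choose (n + 1) = 2 * ((2 * n + 1) choose (n + 1))"
      by simp
    then have c: "of_nat ((2 * (n + 1)) choose (n + 1)) = (2 * of_nat ((2 * n + 1) choose (n + 1)) :: 'a)"
      by (simp only: of_nat_mult of_nat_numeral)
    have pow: "a ^ (2 * (n + 1) + 1) = a * a ^ (2 * n + 2)" by simp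
    have "2 * b * (g * fps_deriv g) $ (n + 1)
        = 2 * b * ((- b) ^ n / a ^ (2 * n + 2) * of_nat ((2 * n + 1) choose (n + 1)))"
      unfolding u w c pow using a by simp
    moreover have "2 * b \<noteq> 0" using False by simp
    ultimately show ?thesis using mult_left_cancel by blast
  qed
qed

theorem theorem6:
  fixes a b :: "'a::field_char_0"
    and p h hbar A :: "'a poly fps"
    and n :: nat
  assumes "a \<noteq> 0"
    and "p = fps_const [:a:] + fps_const [:b:] * fps_X + fps_const [:0, 1:] * fps_X ^ 2"
    and "h = fps_X * p"
    and "hbar = fps_comp_inverse h"
    and "A = fps_quotient fps_X hbar"
  shows "poly (pderiv (A $ (n + 2))) 0
           = (- b) ^ n / a ^ (2 * n + 2) * of_nat ((2 * n + 1) choose (n + 1))"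
proof -
  \<comment> \<open>The linear coefficient of \<open>h\<close> is the constant polynomial a, a unit
    of K[c].\<close>
  have "h $ 0 = 0" "h $ 1 * [:1 / a:] = 1"
    using assms(1) by (simp_all add: assms(2,3) one_pCons)
  then have hbar: "hbar $ 0 = 0" "h oo hbar = fps_X"
    using fps_comp_inverse_works assms(4) by blast+
  then have eq: "(p oo hbar) * hbar = fps_X"
    by (simp add: assms(3) fps_compose_mult_distrib mult.commute)
  then have "hbar \<noteq> 0" by auto
  with eq have "A = p oo hbar" unfolding assms(5) by (rule fps_quotient_eqI)
  then have A: "A = fps_const [:a:] + fps_const [:b:] * hbar + fps_const [:0, 1:] * (hbar * hbar)"
    using hbar by (simp add: assms(2) fps_compose_add_distrib fps_compose_mult_distrib power2_eq_square)
  have Ah: "A * hbar = fps_X" using eq \<open>A = p oo hbar\<close> by simp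
  define g where "g = fps_eval0 hbar"
  define g1 where "g1 = fps_pderiv0 hbar"
  have g0: "g $ 0 = 0" using hbar by (simp add: g_def fps_eval0_def)
  have A0: "fps_eval0 A = fps_const a + fps_const b * g"
    by (simp add: A fps_eval0_simps g_def)
  have A1: "fps_pderiv0 A = fps_const b * g1 + g ^ 2"
    by (simp add: A fps_eval0_simps fps_pderiv0_simps g_def g1_def pderiv_pCons power2_eq_square)
  have g: "fps_const a * g + fps_const b * g ^ 2 = fps_X"
    using arg_cong[OF Ah, of fps_eval0] A0
    by (simp add: fps_eval0_simps algebra_simps power2_eq_square flip: g_def)
  have g1: "fps_pderiv0 A * g + fps_eval0 A * g1 = 0"
    using arg_cong[OF Ah, of fps_pderiv0]
    by (simp add: fps_pderiv0_simps flip: g_def g1_def)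
  have "fps_deriv (fps_const a * g + fps_const b * g ^ 2) = 1" by (simp add: g)
  then have dg: "(fps_const a + 2 * fps_const b * g) * fps_deriv g = 1"
    by (simp add: power2_eq_square algebra_simps)
  \<comment> \<open>Inserting (a + 2bg) g1 = -g^3 into (a + 2bg)(b g1 + g^2) leaves a g^2 + b g^3,
    which is g times the quadratic equal to t.\<close>
  have "(fps_const a + 2 * fps_const b * g) * fps_pderiv0 A = fps_X * g"
    using g1 unfolding A1 A0 g[symmetric] by algebra
  then have "fps_pderiv0 A = fps_X * (g * fps_deriv g)"
    using dg by algebra
  then have "fps_pderiv0 A $ (n + 2) = (g * fps_deriv g) $ (n + 1)"
    by simp
  then show ?thesis
    using quadratic_inverse_mult_deriv_nth[OF assms(1) g0 g, of n]
    by (simp add: fps_pderiv0_def)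
qed

end
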